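(* Let $\mathcal{H}$ be a complex Hilbert space and let $\mathcal{H}^{\infty}\subset\mathcal{H}$ be a dense linear subspace. Let $\{d_j\}_{j\in\mathbb{N}_0}\subset\mathbb{N}$ and let $\{e_j^k\}_{j\in\mathbb{N}_0,\,1\le k\le d_j}$ be an orthonormal basis of $\mathcal{H}$ such that $e_j^k\in\mathcal{H}^{\infty}$ for all $j$ and $k$. Let $H_j:=\mathrm{span}\{e_j^k\}_{k=1}^{d_j}$ and let $P_j:\mathcal{H}\to H_j$ be the orthogonal projection. Let $T:\mathcal{H}^{\infty}\to\mathcal{H}$ be a linear operator. Consider the conditions: (A) For each $j\in\mathbb{N}_0$, $T(H_j)\subset H_j$. (B) For each $\ell\in\mathbb{N}_0$ there exists a matrix $\sigma(\ell)\in\mathbb{C}^{d_\ell\times d_\ell}$ such that for all $e_j^k$ and all $1\le m\le d_\ell$, $$\widehat{Te_j^k}(\ell,m)=\sigma(\ell)_{mk}\,\delta_{j\ell}.$$ (C) For each $\ell\in\mathbb{N}_0$ there exists a matrix $\sigma(\ell)\in\mathbb{C}^{d_\ell\times d_\ell}$ such that $\widehat{Tf}(\ell)=\sigma(\ell)\widehat{f}(\ell)$ for all $f\in\mathcal{H}^{\infty}$. (D) For each $j\in\mathbb{N}_0$, $TP_j=P_jT$ on $\mathcal{H}^{\infty}$. Then (A) and (B) are equivalent, and if in addition $e_j^k$ belongs to the domain of the adjoint $T^*$ for all $j$ and $k$, then (A), (B) and (C) are equivalent. The matrices $\sigma(\ell)$ in (B) and (C) coincide. The equivalent properties (A)--(C)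 follow from (D). If, in addition, $T$ extends to a bounded operator on $\mathcal{H}$, then (D) is equivalent to (A)--(C).
   Context: $\mathbb{N}_0=\mathbb{N}\cup\{0\}$ with $\mathbb{N}=\{1,2,\dots\}$. For $f\in\mathcal{H}$, $\widehat f(j,k):=(f,e_j^k)_{\mathcal{H}}$, and $\widehat f(j)\in\mathbb{C}^{d_j}$ denotes the column vector with entries $\widehat f(j,k)$, $1\le k\le d_j$. $\delta_{j\ell}$ is the Kronecker delta (when $j\neq\ell$ the right-hand side in (B) is $0$). $T^*$ is the Hilbert space adjoint of the densely defined operator $T$ with domain $\mathcal{H}^\infty$. *)

theory Defs
  imports "HOL-Analysis.Analysis" "Jordan_Normal_Form.Matrix"
begin

section \<open>Complex Hilbert spaces\<close>

class complex_vector = real_vector +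
  fixes scaleC :: "complex \<Rightarrow> 'a \<Rightarrow> 'a"  (infixr "*\<^sub>C" 75)
  assumes scaleC_add_right: "a *\<^sub>C (x + y) = a *\<^sub>C x + a *\<^sub>C y"
    and scaleC_add_left: "(a + b) *\<^sub>C x = a *\<^sub>C x + b *\<^sub>C x"
    and scaleC_scaleC: "a *\<^sub>C b *\<^sub>C x = (a * b) *\<^sub>C x"
    and scaleC_one: "1 *\<^sub>C x = x"
    and scaleR_scaleC: "r *\<^sub>R x = complex_of_real r *\<^sub>C x"

interpretation cvec: vector_space "scaleC :: complex \<Rightarrow> 'a \<Rightarrow> 'a::complex_vector"
  by unfold_locales
    (simp_all add: scaleC_add_right scaleC_add_left scaleC_scaleC scaleC_one)

text \<open>The inner product is linear in the first argument and conjugate-linear in the second.\<close>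

class complex_inner = complex_vector + real_normed_vector +
  fixes cinner :: "'a \<Rightarrow> 'a \<Rightarrow> complex"
  assumes cinner_add_left: "cinner (x + y) z = cinner x z + cinner y z"
    and cinner_scaleC_left: "cinner (c *\<^sub>C x) y = c * cinner x y"
    and cinner_commute: "cinner x y = cnj (cinner y x)"
    and cinner_self: "cinner x x = complex_of_real ((norm x)\<^sup>2)"

class chilbert_space = complex_inner + complete_space

definition orth_proj :: "'h::complex_inner set \<Rightarrow> 'h \<Rightarrow> 'h" where
  "orth_proj M x = (THE y. y \<in> M \<and> (\<forall>z\<in>M. cinner (x - y) z = 0))"

section \<open>Densely defined operators\<close>

text \<open>An operator with domain \<open>D\<close> is represented by a total function whose values
  outside \<open>D\<close> are irrelevant.\<close>

definition clinear_on :: "'h::complex_vector set \<Rightarrow> ('h \<Rightarrow> 'h) \<Rightarrow> bool" where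
  "clinear_on D T \<longleftrightarrow>
     (\<forall>x\<in>D. \<forall>y\<in>D. T (x + y) = T x + T y) \<and>
     (\<forall>c. \<forall>x\<in>D. T (c *\<^sub>C x) = c *\<^sub>C T x)"

definition adjoint_domain :: "'h::complex_inner set \<Rightarrow> ('h \<Rightarrow> 'h) \<Rightarrow> 'h set" where
  "adjoint_domain D T = {g. \<exists>h. \<forall>f\<in>D. cinner (T f) g = cinner f h}"

definition extends_bounded :: "'h::complex_inner set \<Rightarrow> ('h \<Rightarrow> 'h) \<Rightarrow> bool" where
  "extends_bounded D T \<longleftrightarrow>
     (\<exists>S. clinear_on UNIV S \<and> (\<exists>K. \<forall>x. norm (S x) \<le> K * norm x) \<and> (\<forall>x\<in>D. S x = T x))"

section \<open>Orthonormal bases in blocks, and invariance\<close>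

text \<open>The vectors of block \<open>j\<close> are \<open>e j k\<close> for \<open>k < d j\<close>: the inner index starts at 0, in
  agreement with the row and column indices of \<^typ>\<open>'a mat\<close> and \<^typ>\<open>'a vec\<close>.\<close>

definition block_onb :: "(nat \<Rightarrow> nat) \<Rightarrow> (nat \<Rightarrow> nat \<Rightarrow> 'h::complex_inner) \<Rightarrow> bool" where
  "block_onb d e \<longleftrightarrow>
     (\<forall>j l. \<forall>k<d j. \<forall>m<d l. cinner (e j k) (e l m) = (if j = l \<and> k = m then 1 else 0)) \<and>
     closure (cvec.span {e j k | j k. k < d j}) = UNIV"

definition block :: "(nat \<Rightarrow> nat) \<Rightarrow> (nat \<Rightarrow> nat \<Rightarrow> 'h::complex_inner) \<Rightarrow> nat \<Rightarrow> 'h set" where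
  "block d e j = cvec.span (e j ` {..<d j})"

definition fourier_coeff :: "(nat \<Rightarrow> nat \<Rightarrow> 'h::complex_inner) \<Rightarrow> 'h \<Rightarrow> nat \<Rightarrow> nat \<Rightarrow> complex" where
  "fourier_coeff e f j k = cinner f (e j k)"

definition fourier_vec ::
    "(nat \<Rightarrow> nat) \<Rightarrow> (nat \<Rightarrow> nat \<Rightarrow> 'h::complex_inner) \<Rightarrow> 'h \<Rightarrow> nat \<Rightarrow> complex Matrix.vec" where
  "fourier_vec d e f j = Matrix.vec (d j) (fourier_coeff e f j)"

definition block_invariant ::
    "(nat \<Rightarrow> nat) \<Rightarrow> (nat \<Rightarrow> nat \<Rightarrow> 'h::complex_inner) \<Rightarrow> ('h \<Rightarrow> 'h) \<Rightarrow> bool" where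
  "block_invariant d e T \<longleftrightarrow> (\<forall>j. T ` block d e j \<subseteq> block d e j)"

definition basis_symbol ::
    "(nat \<Rightarrow> nat) \<Rightarrow> (nat \<Rightarrow> nat \<Rightarrow> 'h::complex_inner) \<Rightarrow> ('h \<Rightarrow> 'h) \<Rightarrow> nat \<Rightarrow> complex mat \<Rightarrow> bool"
where
  "basis_symbol d e T l S \<longleftrightarrow> S \<in> carrier_mat (d l) (d l) \<and>
     (\<forall>j. \<forall>k<d j. \<forall>m<d l.
        fourier_coeff e (T (e j k)) l m = (if j = l then S $$ (m, k) else 0))"

definition fourier_symbol ::
    "(nat \<Rightarrow> nat) \<Rightarrow> (nat \<Rightarrow> nat \<Rightarrow> 'h::complex_inner) \<Rightarrow> 'h set \<Rightarrow> ('h \<Rightarrow> 'h) \<Rightarrow>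
     nat \<Rightarrow> complex mat \<Rightarrow> bool"
where
  "fourier_symbol d e D T l S \<longleftrightarrow> S \<in> carrier_mat (d l) (d l) \<and>
     (\<forall>f\<in>D. fourier_vec d e (T f) l = S *\<^sub>v fourier_vec d e f l)"

definition commutes_with_projections ::
    "(nat \<Rightarrow> nat) \<Rightarrow> (nat \<Rightarrow> nat \<Rightarrow> 'h::complex_inner) \<Rightarrow> 'h set \<Rightarrow> ('h \<Rightarrow> 'h) \<Rightarrow> bool"
where
  "commutes_with_projections d e D T \<longleftrightarrow>
     (\<forall>j. \<forall>f\<in>D. T (orth_proj (block d e j) f) = orth_proj (block d e j) (T f))"

end

theory Submission
  imports Defs
begin

text \<open>
  Everything is read off Fourier coefficients: a vector is determined by its coefficients in the
  orthonormal basis (\<open>onb_eqI\<close>), it lies in a block iff its coefficients outside that block vanish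
  (\<open>in_block_iff\<close>), and the orthogonal projection onto a block keeps the coefficients of the block
  and kills the others (\<open>cinner_orth_proj_block\<close>).

  Conditions (A) and (B) are then the same statement about the coefficients of \<open>T e\<^sub>j\<^sup>k\<close>, and (B) is
  (C) tested on the basis vectors.  Conditions (C) and (D) are equivalent as well
  (\<open>commutes_with_projections_iff\<close>): the product of the symbol with the \<open>l\<close>-th coefficient vector of
  \<open>f\<close> is the \<open>l\<close>-th coefficient vector of \<open>T P\<^sub>l f\<close>, since \<open>P\<^sub>l f\<close> is a finite sum of basis vectors.

  What is left is to pass from (B), which concerns basis vectors, to (C), which concerns the whole
  domain.  As \<open>T\<close> may be discontinuous, an expansion of \<open>f\<close> cannot be pushed through \<open>T\<close> term by
  term, and the adjoint takes over: if \<open>h\<close> represents the functional \<open>f \<mapsto> (T f, e\<^sub>l\<^sup>m)\<close>, then (B)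
  forces \<open>h\<close> to lie in the \<open>l\<close>-th block, so that the functional involves only the \<open>l\<close>-th block of
  coefficients of \<open>f\<close>, through the \<open>m\<close>-th row of the symbol (\<open>basis_imp_fourier_symbol\<close>).  The bounded
  case reduces to this one.  Under (B) the vector \<open>h\<close> can be written down as a finite sum; it
  represents the functional on the basis, and continuity extends this to the whole space
  (\<open>basis_symbol_adjoint_domain\<close>).
\<close>

section \<open>The complex inner product\<close>

lemma cinner_zero_left [simp]: "cinner 0 y = 0"
  using cinner_add_left[of 0 0 y] by simp

lemma cinner_zero_right [simp]: "cinner x 0 = 0"
  using cinner_commute[of x 0] by simp

lemma cinner_minus_left: "cinner (- x) y = - cinner x y"
  using cinner_add_left[of "- x" x y] by (simp add: eq_neg_iff_add_eq_0)

lemma cinner_diff_left: "cinner (x - y) z = cinner x z - cinner y z"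
  using cinner_add_left[of x "- y" z] by (simp add: cinner_minus_left)

lemma cinner_add_right: "cinner x (y + z) = cinner x y + cinner x z"
  using cinner_commute[of x "y + z"] cinner_commute[of x y] cinner_commute[of x z]
  by (simp add: cinner_add_left)

lemma cinner_scaleC_right: "cinner x (c *\<^sub>C y) = cnj c * cinner x y"
  using cinner_commute[of x "c *\<^sub>C y"] cinner_commute[of x y]
  by (simp add: cinner_scaleC_left)

lemma cinner_sum_left: "cinner (\<Sum>i\<in>I. f i) y = (\<Sum>i\<in>I. cinner (f i) y)"
  by (induction I rule: infinite_finite_induct) (simp_all add: cinner_add_left)

lemma cinner_sum_right: "cinner x (\<Sum>i\<in>I. f i) = (\<Sum>i\<in>I. cinner x (f i))"
  by (induction I rule: infinite_finite_induct) (simp_all add: cinner_add_right)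

lemma cinner_self_eq_zero_iff [simp]: "cinner x x = 0 \<longleftrightarrow> x = 0"
  by (simp add: cinner_self)

lemma cinner_eq_zero_sym: "cinner x y = 0 \<longleftrightarrow> cinner y x = 0"
  using cinner_commute[of x y] cinner_commute[of y x] by auto

text \<open>The Cauchy--Schwarz inequality is Pythagoras for the decomposition of \<open>x\<close> into its projection
  \<open>c y\<close> onto the line through \<open>y\<close> and the orthogonal remainder \<open>z\<close>, with the term for \<open>z\<close> dropped.\<close>

lemma cmod_cinner_le: "cmod (cinner x y) \<le> norm x * norm y"
proof (cases "y = 0")
  case False
  define c where "c = cinner x y / cinner y y"
  define z where "z = x - c *\<^sub>C y"
  have zy: "cinner z y = 0"
    using False by (simp add: z_def c_def cinner_diff_left cinner_scaleC_left)
  hence yz: "cinner y z = 0"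
    by (simp add: cinner_eq_zero_sym)
  have x: "x = z + c *\<^sub>C y"
    by (simp add: z_def)
  have "cinner x x = cinner z z + c * cnj c * cinner y y"
    unfolding x
    by (simp add: cinner_add_left cinner_add_right cinner_scaleC_left cinner_scaleC_right zy yz)
  hence "complex_of_real ((norm x)\<^sup>2) =
      complex_of_real ((norm z)\<^sup>2 + (cmod c)\<^sup>2 * (norm y)\<^sup>2)"
    by (simp only: cinner_self complex_norm_square[symmetric] of_real_add of_real_mult)
  hence "(norm x)\<^sup>2 = (norm z)\<^sup>2 + (cmod c)\<^sup>2 * (norm y)\<^sup>2"
    using of_real_eq_iff by blast
  hence "(cmod c * norm y)\<^sup>2 \<le> (norm x)\<^sup>2"
    by (simp add: power_mult_distrib)
  hence "cmod c * norm y \<le> norm x"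
    by (rule power2_le_imp_le) simp
  moreover have "cmod c * norm y = cmod (cinner x y) / norm y"
    using False by (simp add: c_def cinner_self norm_divide norm_power power2_eq_square norm_mult)
  ultimately show ?thesis
    using False by (simp add: pos_divide_le_eq)
qed simp

lemma bounded_linear_cinner_left: "bounded_linear (\<lambda>x. cinner x y)"
  by (rule bounded_linear_intro[of _ "norm y"])
    (simp_all add: cinner_add_left scaleR_scaleC cinner_scaleC_left cmod_cinner_le
      scaleR_conv_of_real[where 'a = complex])

section \<open>Linear operators on a subspace\<close>

lemma clinear_on_sum:
  assumes "cvec.subspace D" "clinear_on D T" "\<And>i. i \<in> I \<Longrightarrow> v i \<in> D"
  shows "T (\<Sum>i\<in>I. c i *\<^sub>C v i) = (\<Sum>i\<in>I. c i *\<^sub>C T (v i))"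
proof -
  (* The empty sum: T 0 = 0 because 0 is the multiple by the scalar 0 of a vector of D. *)
  have "T (0 *\<^sub>C 0) = 0 *\<^sub>C T 0"
    using assms(1,2) unfolding clinear_on_def cvec.subspace_def by blast
  hence zero: "T 0 = 0"
    by simp
  have "finite I \<Longrightarrow> (\<And>i. i \<in> I \<Longrightarrow> v i \<in> D) \<Longrightarrow> ?thesis"
  proof (induction I rule: finite_induct)
    case (insert i I)
    have "c i *\<^sub>C v i \<in> D" "(\<Sum>i\<in>I. c i *\<^sub>C v i) \<in> D"
      using assms(1) insert.prems by (auto intro!: cvec.subspace_scale cvec.subspace_sum)
    thus ?case
      using insert assms(2) by (simp add: clinear_on_def)
  qed (simp add: zero)
  thus ?thesis
    using assms(3) zero by (cases "finite I") auto
qed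

section \<open>Expansion in an orthonormal basis\<close>

context
  fixes d :: "nat \<Rightarrow> nat" and e :: "nat \<Rightarrow> nat \<Rightarrow> 'h::complex_inner"
  assumes onb: "block_onb d e"
begin

lemma cinner_onb:
  "k < d j \<Longrightarrow> m < d l \<Longrightarrow> cinner (e j k) (e l m) = (if j = l \<and> k = m then 1 else 0)"
  using onb unfolding block_onb_def by blast

text \<open>The span of the basis is dense, so a linear identity between continuous maps holds everywhere
  as soon as it holds on the basis vectors.\<close>

lemma closed_subspace_eq_UNIV:
  assumes "cvec.subspace V" "closed V" "\<And>j k. k < d j \<Longrightarrow> e j k \<in> V"
  shows "V = UNIV"
proof -
  have "cvec.span {e j k | j k. k < d j} \<subseteq> V"
    using assms by (intro cvec.span_minimal) auto
  hence "closure (cvec.span {e j k | j k. k < d j}) \<subseteq> V"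
    using assms(2) by (rule closure_minimal)
  thus ?thesis
    using onb unfolding block_onb_def by auto
qed

text \<open>The vectors orthogonal to \<open>x - y\<close> form a closed subspace; once it contains the basis it contains
  \<open>x - y\<close> itself.\<close>

lemma onb_eqI:
  assumes "\<And>j k. k < d j \<Longrightarrow> cinner x (e j k) = cinner y (e j k)"
  shows "x = y"
proof -
  let ?V = "{z. cinner z (x - y) = 0}"
  have "cvec.subspace ?V"
    by (auto simp: cvec.subspace_def cinner_add_left cinner_scaleC_left)
  moreover have "closed ?V"
    by (intro closed_Collect_eq continuous_intros
        linear_continuous_on[OF bounded_linear_cinner_left])
  moreover have "e j k \<in> ?V" if "k < d j" for j k
    using assms[OF that] by (simp add: cinner_eq_zero_sym[of "e j k"] cinner_diff_left)
  ultimately have "?V = UNIV"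
    by (rule closed_subspace_eq_UNIV)
  hence "cinner (x - y) (x - y) = 0"
    by blast
  thus ?thesis
    by simp
qed

lemma onb_in_block: "k < d j \<Longrightarrow> e j k \<in> block d e j"
  by (auto simp: block_def intro: cvec.span_base)

lemma sum_in_block: "(\<Sum>k<d j. c k *\<^sub>C e j k) \<in> block d e j"
  using onb_in_block unfolding block_def
  by (intro cvec.span_sum cvec.span_scale) auto

lemma cinner_sum_onb:
  assumes "m < d l"
  shows "cinner (\<Sum>k<d j. c k *\<^sub>C e j k) (e l m) = (if j = l then c m else 0)"
proof -
  have "cinner (\<Sum>k<d j. c k *\<^sub>C e j k) (e l m) = (\<Sum>k<d j. if j = l \<and> k = m then c k else 0)"
    using assms by (auto simp: cinner_sum_left cinner_scaleC_left cinner_onb intro!: sum.cong)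
  thus ?thesis
    using assms by auto
qed

lemma cinner_block_other:
  assumes "x \<in> block d e j" "m < d l" "l \<noteq> j"
  shows "cinner x (e l m) = 0"
proof -
  have "block d e j \<subseteq> {x. cinner x (e l m) = 0}"
    unfolding block_def using assms(2,3)
    by (intro cvec.span_minimal)
      (auto simp: cinner_onb cvec.subspace_def cinner_add_left cinner_scaleC_left)
  thus ?thesis
    using assms(1) by blast
qed

lemma block_expansion:
  assumes "\<And>l m. m < d l \<Longrightarrow> l \<noteq> j \<Longrightarrow> cinner x (e l m) = 0"
  shows "x = (\<Sum>k<d j. cinner x (e j k) *\<^sub>C e j k)"
  using assms by (intro onb_eqI) (auto simp: cinner_sum_onb)

lemma in_block_iff:
  "x \<in> block d e j \<longleftrightarrow> (\<forall>l m. m < d l \<longrightarrow> l \<noteq> j \<longrightarrow> cinner x (e l m) = 0)"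
proof
  assume "\<forall>l m. m < d l \<longrightarrow> l \<noteq> j \<longrightarrow> cinner x (e l m) = 0"
  hence "x = (\<Sum>k<d j. cinner x (e j k) *\<^sub>C e j k)"
    by (intro block_expansion) blast
  also have "\<dots> \<in> block d e j"
    by (rule sum_in_block)
  finally show "x \<in> block d e j" .
qed (use cinner_block_other in blast)

lemma orth_proj_block: "orth_proj (block d e j) x = (\<Sum>k<d j. cinner x (e j k) *\<^sub>C e j k)"
  (is "_ = ?p")
  unfolding orth_proj_def
proof (rule the_equality)
  have "cvec.subspace {z. cinner w z = 0}" for w :: 'h
    by (simp add: cvec.subspace_def cinner_add_right cinner_scaleC_right)
  moreover have "e j ` {..<d j} \<subseteq> {z. cinner (x - ?p) z = 0}"
    by (auto simp: cinner_diff_left cinner_sum_onb)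
  ultimately have "block d e j \<subseteq> {z. cinner (x - ?p) z = 0}"
    unfolding block_def by (intro cvec.span_minimal)
  thus "?p \<in> block d e j \<and> (\<forall>z\<in>block d e j. cinner (x - ?p) z = 0)"
    by (intro conjI sum_in_block) blast
next
  fix y assume y: "y \<in> block d e j \<and> (\<forall>z\<in>block d e j. cinner (x - y) z = 0)"
  have "cinner y (e j k) = cinner x (e j k)" if "k < d j" for k
    using y onb_in_block[OF that] by (auto simp: cinner_diff_left)
  hence "(\<Sum>k<d j. cinner y (e j k) *\<^sub>C e j k) = ?p"
    by (intro sum.cong) auto
  moreover have "y = (\<Sum>k<d j. cinner y (e j k) *\<^sub>C e j k)"
    using y by (intro block_expansion) (blast intro: cinner_block_other)
  ultimately show "y = ?p"
    by (rule trans[rotated])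
qed

lemma cinner_orth_proj_block:
  "m < d l \<Longrightarrow> cinner (orth_proj (block d e j) x) (e l m) = (if j = l then cinner x (e l m) else 0)"
  by (simp add: orth_proj_block cinner_sum_onb)

section \<open>Symbols\<close>

lemma basis_symbol_iff:
  "basis_symbol d e T l S \<longleftrightarrow> S \<in> carrier_mat (d l) (d l) \<and>
    (\<forall>j. \<forall>k<d j. \<forall>m<d l. cinner (T (e j k)) (e l m) = (if j = l then S $$ (m, k) else 0))"
  by (simp add: basis_symbol_def fourier_coeff_def)

lemma fourier_symbol_iff:
  "fourier_symbol d e D T l S \<longleftrightarrow> S \<in> carrier_mat (d l) (d l) \<and>
    (\<forall>f\<in>D. \<forall>m<d l. cinner (T f) (e l m) = (\<Sum>k<d l. S $$ (m, k) * cinner f (e l k)))"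
  unfolding fourier_symbol_def
proof (intro conj_cong refl ball_cong)
  fix f assume S: "S \<in> carrier_mat (d l) (d l)"
  have "vec_index (S *\<^sub>v fourier_vec d e f l) m = (\<Sum>k<d l. S $$ (m, k) * cinner f (e l k))"
    if "m < d l" for m
    using S that
    by (simp add: scalar_prod_def fourier_vec_def fourier_coeff_def lessThan_atLeast0)
  moreover have "dim_vec (S *\<^sub>v fourier_vec d e f l) = d l"
    using S by simp
  ultimately show "fourier_vec d e (T f) l = S *\<^sub>v fourier_vec d e f l \<longleftrightarrow>
      (\<forall>m<d l. cinner (T f) (e l m) = (\<Sum>k<d l. S $$ (m, k) * cinner f (e l k)))"
    by (simp add: Matrix.vec_eq_iff fourier_vec_def fourier_coeff_def)
qed

lemma basis_symbol_unique:
  assumes "basis_symbol d e T l S" "basis_symbol d e T l S'"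
  shows "S = S'"
proof (intro eq_matI)
  fix i j assume "i < dim_row S'" "j < dim_col S'"
  hence "i < d l" "j < d l"
    using assms(2) by (auto simp: basis_symbol_iff)
  hence "S $$ (i, j) = cinner (T (e l j)) (e l i)" "S' $$ (i, j) = cinner (T (e l j)) (e l i)"
    using assms[unfolded basis_symbol_iff] by metis+
  thus "S $$ (i, j) = S' $$ (i, j)"
    by simp
qed (use assms in \<open>auto simp: basis_symbol_iff\<close>)

lemma fourier_imp_basis_symbol:
  assumes "fourier_symbol d e D T l S" "\<And>j k. k < d j \<Longrightarrow> e j k \<in> D"
  shows "basis_symbol d e T l S"
  unfolding basis_symbol_iff
proof (intro conjI allI impI)
  fix j k m assume k: "k < d j" and m: "m < d l"
  have "cinner (T (e j k)) (e l m) = (\<Sum>i<d l. S $$ (m, i) * cinner (e j k) (e l i))"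
    using assms k m by (auto simp: fourier_symbol_iff)
  also have "\<dots> = (\<Sum>i<d l. if j = l \<and> i = k then S $$ (m, i) else 0)"
    using k by (intro sum.cong) (auto simp: cinner_onb)
  also have "\<dots> = (if j = l then S $$ (m, k) else 0)"
    using k by auto
  finally show "cinner (T (e j k)) (e l m) = (if j = l then S $$ (m, k) else 0)" .
qed (use assms in \<open>auto simp: fourier_symbol_iff\<close>)

text \<open>The vector \<open>h\<close> representing \<open>f \<mapsto> (T f, e\<^sub>l\<^sup>m)\<close> has \<open>(h, e\<^sub>j\<^sup>k) = cnj (T e\<^sub>j\<^sup>k, e\<^sub>l\<^sup>m)\<close>.  So its
  coefficients outside block \<open>l\<close> vanish and those inside are the conjugated entries of row \<open>m\<close> of
  the symbol; conjugate-linearity of the inner product in \<open>h\<close> undoes the conjugation.\<close>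

lemma basis_imp_fourier_symbol:
  assumes S: "basis_symbol d e T l S"
    and D: "\<And>j k. k < d j \<Longrightarrow> e j k \<in> D"
    and adj: "\<And>m. m < d l \<Longrightarrow> e l m \<in> adjoint_domain D T"
  shows "fourier_symbol d e D T l S"
  unfolding fourier_symbol_iff
proof (intro conjI ballI allI impI)
  fix f m assume f: "f \<in> D" and m: "m < d l"
  obtain h where h: "\<And>f. f \<in> D \<Longrightarrow> cinner (T f) (e l m) = cinner f h"
    using adj[OF m] unfolding adjoint_domain_def by blast
  have coeff: "cinner h (e j k) = (if j = l then cnj (S $$ (m, k)) else 0)" if "k < d j" for j k
  proof -
    have "cinner h (e j k) = cnj (cinner (T (e j k)) (e l m))"
      using h[OF D[OF that]] cinner_commute[of h "e j k"] by simp
    thus ?thesis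
      using S m that by (simp add: basis_symbol_iff)
  qed
  have "h = (\<Sum>k<d l. cinner h (e l k) *\<^sub>C e l k)"
    using coeff by (intro block_expansion) auto
  also have "\<dots> = (\<Sum>k<d l. cnj (S $$ (m, k)) *\<^sub>C e l k)"
    using coeff by (intro sum.cong) auto
  finally have "cinner f h = (\<Sum>k<d l. S $$ (m, k) * cinner f (e l k))"
    by (simp add: cinner_sum_right cinner_scaleC_right)
  thus "cinner (T f) (e l m) = (\<Sum>k<d l. S $$ (m, k) * cinner f (e l k))"
    using h[OF f] by simp
qed (use S in \<open>simp add: basis_symbol_iff\<close>)

text \<open>The coefficients found in the previous proof give the only candidate for the representing
  vector.  It represents \<open>f \<mapsto> (T f, e\<^sub>l\<^sup>m)\<close> on the basis, hence everywhere when \<open>T\<close> is bounded.\<close>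

lemma basis_symbol_adjoint_domain:
  assumes S: "basis_symbol d e T l S"
    and D: "\<And>j k. k < d j \<Longrightarrow> e j k \<in> D"
    and bd: "extends_bounded D T" and m: "m < d l"
  shows "e l m \<in> adjoint_domain D T"
proof -
  obtain B K where lin: "clinear_on UNIV B" and K: "\<And>x. norm (B x) \<le> K * norm x"
    and B: "\<And>x. x \<in> D \<Longrightarrow> B x = T x"
    using bd unfolding extends_bounded_def by blast
  have bl: "bounded_linear B"
    using lin K by (intro bounded_linear_intro[of _ K])
      (auto simp: clinear_on_def scaleR_scaleC mult.commute)
  define h where "h = (\<Sum>k<d l. cnj (S $$ (m, k)) *\<^sub>C e l k)"
  let ?V = "{x. cinner (B x) (e l m) = cinner x h}"
  have "cvec.subspace ?V"
  proof -
    have "B 0 = 0"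
      using bl by (simp add: linear_simps)
    thus ?thesis
      using lin by (auto simp: cvec.subspace_def clinear_on_def cinner_add_left cinner_scaleC_left)
  qed
  moreover have "closed ?V"
    by (intro closed_Collect_eq linear_continuous_on bounded_linear_cinner_left
        bounded_linear_compose[OF bounded_linear_cinner_left bl])
  moreover have "e j k \<in> ?V" if "k < d j" for j k
    using S m that cinner_commute[of "e j k" h]
    by (simp add: B D h_def cinner_sum_onb basis_symbol_iff)
  ultimately have "?V = UNIV"
    by (rule closed_subspace_eq_UNIV)
  hence "\<forall>f\<in>D. cinner (T f) (e l m) = cinner f h"
    by (auto simp: set_eq_iff simp flip: B)
  thus ?thesis
    unfolding adjoint_domain_def by blast
qed

section \<open>Invariant blocks and commuting with the projections\<close>

context
  fixes D :: "'h set" and T :: "'h \<Rightarrow> 'h"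
  assumes D: "cvec.subspace D" and eD: "\<And>j k. k < d j \<Longrightarrow> e j k \<in> D" and T: "clinear_on D T"
begin

lemma block_invariant_iff_basis:
  "block_invariant d e T \<longleftrightarrow> (\<forall>j. \<forall>k<d j. T (e j k) \<in> block d e j)"
proof
  assume inv: "\<forall>j. \<forall>k<d j. T (e j k) \<in> block d e j"
  have "T x \<in> block d e j" if "x \<in> block d e j" for x j
  proof -
    have "x = (\<Sum>k<d j. cinner x (e j k) *\<^sub>C e j k)"
      using that by (intro block_expansion) (auto simp: in_block_iff)
    hence "T x = (\<Sum>k<d j. cinner x (e j k) *\<^sub>C T (e j k))"
      using clinear_on_sum[OF D T, of "{..<d j}" "e j" "\<lambda>k. cinner x (e j k)"] eD by simp
    also have "\<dots> \<in> block d e j"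
      using inv unfolding block_def by (intro cvec.span_sum cvec.span_scale) auto
    finally show ?thesis .
  qed
  thus "block_invariant d e T"
    by (auto simp: block_invariant_def)
qed (use onb_in_block in \<open>blast dest: block_invariant_def[THEN iffD1]\<close>)

lemma block_invariant_iff_basis_symbol:
  "block_invariant d e T \<longleftrightarrow> (\<forall>l. \<exists>S. basis_symbol d e T l S)"
proof
  assume "block_invariant d e T"
  hence "basis_symbol d e T l (mat (d l) (d l) (\<lambda>(m, k). cinner (T (e l k)) (e l m)))" for l
    by (auto simp: block_invariant_iff_basis basis_symbol_iff in_block_iff)
  thus "\<forall>l. \<exists>S. basis_symbol d e T l S"
    by blast
next
  assume "\<forall>l. \<exists>S. basis_symbol d e T l S"
  thus "block_invariant d e T"
    unfolding block_invariant_iff_basis in_block_iff basis_symbol_iff by fastforce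
qed

lemma cinner_apply_orth_proj_block:
  "cinner (T (orth_proj (block d e j) f)) y =
    (\<Sum>k<d j. cinner (T (e j k)) y * cinner f (e j k))"
proof -
  have "T (orth_proj (block d e j) f) = (\<Sum>k<d j. cinner f (e j k) *\<^sub>C T (e j k))"
    unfolding orth_proj_block using eD by (intro clinear_on_sum[OF D T]) auto
  thus ?thesis
    by (simp add: cinner_sum_left cinner_scaleC_left mult.commute)
qed

text \<open>\<open>(T P\<^sub>l f, e\<^sub>l\<^sup>m)\<close> is the matrix product in (C), because \<open>P\<^sub>l f\<close> is a finite sum of basis vectors,
  and \<open>(P\<^sub>l T f, e\<^sub>l\<^sup>m)\<close> is \<open>(T f, e\<^sub>l\<^sup>m)\<close>.  Off block \<open>l\<close>, \<open>P\<^sub>l T f\<close> has no coefficients, and \<open>T P\<^sub>l f\<close> has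
  none by (B), which is contained in (C).\<close>

lemma commutes_with_projections_iff:
  "commutes_with_projections d e D T \<longleftrightarrow> (\<forall>l. \<exists>S. fourier_symbol d e D T l S)"
proof
  assume comm: "commutes_with_projections d e D T"
  have "fourier_symbol d e D T l (mat (d l) (d l) (\<lambda>(m, k). cinner (T (e l k)) (e l m)))" for l
    unfolding fourier_symbol_iff
  proof (intro conjI ballI allI impI)
    fix f m assume f: "f \<in> D" and m: "m < d l"
    have "cinner (T f) (e l m) = cinner (orth_proj (block d e l) (T f)) (e l m)"
      using m by (simp add: cinner_orth_proj_block)
    also have "\<dots> = cinner (T (orth_proj (block d e l) f)) (e l m)"
      using comm f by (simp add: commutes_with_projections_def)
    finally show "cinner (T f) (e l m) = (\<Sum>k<d l.
        mat (d l) (d l) (\<lambda>(m, k). cinner (T (e l k)) (e l m)) $$ (m, k) * cinner f (e l k))"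
      using m by (simp add: cinner_apply_orth_proj_block)
  qed simp
  thus "\<forall>l. \<exists>S. fourier_symbol d e D T l S"
    by blast
next
  assume "\<forall>l. \<exists>S. fourier_symbol d e D T l S"
  then obtain S where C: "\<And>l. fourier_symbol d e D T l (S l)"
    by metis
  have B: "basis_symbol d e T l (S l)" for l
    using C eD by (rule fourier_imp_basis_symbol)
  show "commutes_with_projections d e D T"
    unfolding commutes_with_projections_def
  proof (intro allI ballI onb_eqI)
    fix j f l m assume f: "f \<in> D" and m: "m < d l"
    have "cinner (T (orth_proj (block d e j) f)) (e l m) =
        (\<Sum>k<d j. (if j = l then S l $$ (m, k) else 0) * cinner f (e j k))"
      unfolding cinner_apply_orth_proj_block
      using B m by (intro sum.cong) (auto simp: basis_symbol_iff)
    also have "\<dots> = (if j = l then cinner (T f) (e l m) else 0)"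
      using C[of l] f m by (auto simp: fourier_symbol_iff)
    finally show "cinner (T (orth_proj (block d e j) f)) (e l m) =
        cinner (orth_proj (block d e j) (T f)) (e l m)"
      using m by (simp add: cinner_orth_proj_block)
  qed
qed

end

end

section \<open>Equivalence of the conditions\<close>

theorem theorem2p1:
  fixes D :: "'h::chilbert_space set"
    and d :: "nat \<Rightarrow> nat"
    and e :: "nat \<Rightarrow> nat \<Rightarrow> 'h"
    and T :: "'h \<Rightarrow> 'h"
  assumes "cvec.subspace D"
    and "closure D = UNIV"
    and "\<forall>j. 1 \<le> d j"
    and "block_onb d e"
    and "\<forall>j. \<forall>k<d j. e j k \<in> D"
    and "clinear_on D T"
  shows "(block_invariant d e T \<longleftrightarrow> (\<forall>l. \<exists>S. basis_symbol d e T l S))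
    \<and> ((\<forall>j. \<forall>k<d j. e j k \<in> adjoint_domain D T) \<longrightarrow>
         (block_invariant d e T \<longleftrightarrow> (\<forall>l. \<exists>S. basis_symbol d e T l S)) \<and>
         ((\<forall>l. \<exists>S. basis_symbol d e T l S) \<longleftrightarrow> (\<forall>l. \<exists>S. fourier_symbol d e D T l S)))
    \<and> (\<forall>l S S'. basis_symbol d e T l S \<longrightarrow> fourier_symbol d e D T l S' \<longrightarrow> S = S')
    \<and> (commutes_with_projections d e D T \<longrightarrow>
         block_invariant d e T \<and>
         (\<forall>l. \<exists>S. basis_symbol d e T l S) \<and>
         (\<forall>l. \<exists>S. fourier_symbol d e D T l S))
    \<and> (extends_bounded D T \<longrightarrow>
         (commutes_with_projections d e D T \<longleftrightarrow> block_invariant d e T) \<and>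
         (commutes_with_projections d e D T \<longleftrightarrow> (\<forall>l. \<exists>S. basis_symbol d e T l S)) \<and>
         (commutes_with_projections d e D T \<longleftrightarrow> (\<forall>l. \<exists>S. fourier_symbol d e D T l S)))"
proof -
  let ?A = "block_invariant d e T" and ?B = "\<forall>l. \<exists>S. basis_symbol d e T l S"
    and ?C = "\<forall>l. \<exists>S. fourier_symbol d e D T l S" and ?D = "commutes_with_projections d e D T"
  have eD: "\<And>j k. k < d j \<Longrightarrow> e j k \<in> D"
    using assms(5) by blast
  have AB: "?A \<longleftrightarrow> ?B"
    by (rule block_invariant_iff_basis_symbol[OF assms(4,1) eD assms(6)])
  have CD: "?D \<longleftrightarrow> ?C"
    by (rule commutes_with_projections_iff[OF assms(4,1) eD assms(6)])
  have CB: "basis_symbol d e T l S" if "fourier_symbol d e D T l S" for l S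
    by (rule fourier_imp_basis_symbol[OF assms(4) that eD])
  have BC: "(\<forall>j. \<forall>k<d j. e j k \<in> adjoint_domain D T) \<longrightarrow> ?B \<longrightarrow> ?C"
  proof (intro impI allI)
    fix l assume adj: "\<forall>j. \<forall>k<d j. e j k \<in> adjoint_domain D T" and ?B
    then obtain S where "basis_symbol d e T l S"
      by blast
    hence "fourier_symbol d e D T l S"
      by (rule basis_imp_fourier_symbol[OF assms(4)]) (use eD adj in simp_all)
    thus "\<exists>S. fourier_symbol d e D T l S"
      by blast
  qed
  have bounded: "extends_bounded D T \<longrightarrow> ?B \<longrightarrow> ?C"
  proof (intro impI)
    assume bd: "extends_bounded D T" and B: ?B
    have "\<forall>j. \<forall>k<d j. e j k \<in> adjoint_domain D T"
    proof (intro allI impI)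
      fix j k assume k: "k < d j"
      obtain S where "basis_symbol d e T j S"
        using B by blast
      thus "e j k \<in> adjoint_domain D T"
        by (rule basis_symbol_adjoint_domain[OF assms(4) _ eD bd k])
    qed
    thus ?C
      using B by (rule BC[THEN mp, THEN mp])
  qed
  have uniq: "\<forall>l S S'. basis_symbol d e T l S \<longrightarrow> fourier_symbol d e D T l S' \<longrightarrow> S = S'"
    using basis_symbol_unique[OF assms(4)] CB by blast
  have C_imp_B: "?C \<longrightarrow> ?B"
    using CB by blast
  show ?thesis
    unfolding AB CD using C_imp_B BC bounded by (intro conjI uniq; satx)
qed

end
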